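(* Any (possibly randomized) PSA for the $VC(k)$ problem requires $\Omega(k^2)$ space (bits), even when the stream consists only of edge insertions.
   Context: A vertex cover of an undirected graph $G=(V,E)$ is a set $C\subseteq V$ such that every edge has at least one endpoint in $C$. $VC(k)$: given a graph $G$ and $k\in\mathbb{N}$, either return a vertex cover of size at most $k$ or report that none exists. The graph is given as an insertion-only stream of edges; a PSA (parameterized streaming algorithm) is a one-pass streaming algorithm that maintains a sketch and, from the sketch, at any time either outputs a vertex cover of size at most $k$ of the graph formed by the edges inserted so far or reports that none exists. The space of the algorithm is the size of the memory it maintains. *)

theory Defs
  imports "HOL-Probability.Probability"
begin

text \<open>Undirected simple graphs are given by a vertex set and a set of two-element sets of vertices.\<close>

definition vertex_cover :: "'v set \<Rightarrow> 'v set set \<Rightarrow> 'v set \<Rightarrow> bool" where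
  "vertex_cover V E C \<longleftrightarrow> C \<subseteq> V \<and> (\<forall>e\<in>E. e \<inter> C \<noteq> {})"

text \<open>Insertion-only streams on the vertex set \<open>{..<n}\<close>. An edge is inserted at most once, so that
  the graph formed by a stream \<open>es\<close> is the simple graph with edge set \<open>set es\<close>.\<close>

definition edge_streams :: "nat \<Rightarrow> nat set list set" where
  "edge_streams n = {es. distinct es \<and> (\<forall>e\<in>set es. e \<subseteq> {..<n} \<and> card e = 2)}"

text \<open>A one-pass streaming algorithm. The memory content (the sketch) is a bit string; the
  algorithm may use fresh coins in every step, but coins that are to be reused later have to be
  kept in the sketch. Deterministic algorithms are those with \<^const>\<open>return_pmf\<close>
  everywhere. An answer \<open>Some C\<close> is a claimed vertex cover, \<open>None\<close> is the report that none exists.\<close>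

record streaming_alg =
  initial :: "bool list pmf"
  update :: "bool list \<Rightarrow> nat set \<Rightarrow> bool list pmf"
  answer :: "bool list \<Rightarrow> nat set option pmf"

definition sketch :: "streaming_alg \<Rightarrow> nat set list \<Rightarrow> bool list pmf" where
  "sketch A es = foldl (\<lambda>M e. bind_pmf M (\<lambda>m. update A m e)) (initial A) es"

definition result :: "streaming_alg \<Rightarrow> nat set list \<Rightarrow> nat set option pmf" where
  "result A es = bind_pmf (sketch A es) (answer A)"

fun correct_VC :: "'v set \<Rightarrow> nat \<Rightarrow> 'v set set \<Rightarrow> 'v set option \<Rightarrow> bool" where
  "correct_VC V k E (Some C) \<longleftrightarrow> vertex_cover V E C \<and> finite C \<and> card C \<le> k"
| "correct_VC V k E None \<longleftrightarrow> \<not> (\<exists>C. vertex_cover V E C \<and> finite C \<and> card C \<le> k)"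

text \<open>Since \<^const>\<open>edge_streams\<close> is closed under prefixes, the condition below demands a
  correct answer, with probability at least \<open>p\<close>, at every point of every stream. The algorithm may
  depend on \<open>n\<close> and \<open>k\<close>.\<close>

definition is_PSA_VC :: "real \<Rightarrow> nat \<Rightarrow> nat \<Rightarrow> streaming_alg \<Rightarrow> bool" where
  "is_PSA_VC p n k A \<longleftrightarrow>
     (\<forall>es\<in>edge_streams n. measure_pmf.prob (result A es) {a. correct_VC {..<n} k (set es) a} \<ge> p)"

text \<open>Worst-case number of bits of memory, over all streams on \<open>n\<close> vertices, all points
  of the stream and all coin tosses.\<close>

definition space_used :: "nat \<Rightarrow> streaming_alg \<Rightarrow> enat" where
  "space_used n A = (SUP es\<in>edge_streams n. SUP m\<in>set_pmf (sketch A es). enat (length m))"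

end

theory Submission
  imports Defs
begin

text \<open>
  This is the one-way communication lower bound for INDEX. Any graph \<open>X\<close> on \<open>k + 2\<close>
  vertices can be streamed; to query a pair \<open>e\<close>, attach a pendant edge to each of the \<open>k\<close> vertices
  outside \<open>e\<close>. Those pendant edges form a matching of size \<open>k\<close> avoiding \<open>e\<close>, so a vertex cover of
  size \<open>k\<close> exists iff \<open>e\<close> is not an edge of \<open>X\<close>. Thus from the sketch of \<open>X\<close> each of the
  \<open>N = (k + 2) choose 2\<close> bits of \<open>X\<close> can be guessed with probability \<open>p\<close>. By averaging over the coins,
  every \<open>X\<close> has a sketch from which the expected number of correct guesses is at least \<open>p N\<close>, while a
  Chernoff bound shows that a single sketch has this property only for a fraction
  \<open>exp (- 2 (p - 1/2)\<^sup>2 N)\<close> of all \<open>X\<close>. Hence the number of sketches is exponential in \<open>N\<close>.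
\<close>

section \<open>Exponential moments and the lower bound for INDEX\<close>

text \<open>Moment bound for a fair random sign \<epsilon>, as \<open>cosh x\<close> is the
  expectation of exp (\<epsilon> x). For nonnegative arguments it is the inequality behind
  Hoeffding's lemma with parameters \<open>2 * y\<close> and \<open>1/2\<close>, exponentiated and
  rescaled by \<open>exp (- y)\<close>; evenness gives the rest.\<close>

lemma cosh_le_exp_square: "cosh (x::real) \<le> exp (x\<^sup>2 / 2)"
proof -
  have *: "cosh y \<le> exp (y\<^sup>2 / 2)" if "y \<ge> 0" for y :: real
  proof -
    have "- (2 * y) * (1/2) + ln (1 + 1/2 * (exp (2 * y) - 1)) \<le> (2 * y)\<^sup>2 / 8"
      using that by (intro Hoeffdings_lemma_aux) auto
    hence "ln ((1 + exp (2 * y)) / 2) \<le> y + y\<^sup>2 / 2"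
      by (simp add: field_simps power2_eq_square)
    hence "exp (ln ((1 + exp (2 * y)) / 2)) \<le> exp (y + y\<^sup>2 / 2)"
      by (simp only: exp_le_cancel_iff)
    hence "(1 + exp (2 * y)) / 2 \<le> exp (y + y\<^sup>2 / 2)"
      by (subst (asm) exp_ln) (auto intro: add_pos_pos)
    hence "exp (- y) * ((1 + exp (2 * y)) / 2) \<le> exp (- y) * exp (y + y\<^sup>2 / 2)"
      by (intro mult_left_mono) auto
    thus ?thesis
      by (simp add: cosh_field_def field_simps flip: exp_add)
  qed
  show ?thesis
    using *[of "\<bar>x\<bar>"] by (cases "x \<ge> 0") auto
qed

text \<open>The distributive law. It stands in for independence of the memberships of a uniformly
  random \<open>X\<close>: exponential moments factor over \<open>I\<close>.\<close>

lemma sum_Pow_prod_if: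
  fixes f g :: "'a \<Rightarrow> 'b :: comm_semiring_1"
  assumes "finite I"
  shows "(\<Sum>X\<in>Pow I. \<Prod>i\<in>I. if i \<in> X then f i else g i) = (\<Prod>i\<in>I. f i + g i)"
proof -
  have "(\<Prod>i\<in>I. if i \<in> X then f i else g i) = prod f X * prod g (I - X)" if "X \<in> Pow I" for X
  proof -
    have "I \<inter> {i. i \<in> X} = X" "I \<inter> - {i. i \<in> X} = I - X"
      using that by auto
    thus ?thesis
      using prod.If_cases[OF assms, of "\<lambda>i. i \<in> X" f g] by simp
  qed
  thus ?thesis
    by (simp add: prod_add[OF assms])
qed

text \<open>Here \<open>q m i\<close> is the probability with which the decoder, holding the message \<open>m\<close>, claims \<open>i \<in> X\<close>.\<close>

theorem index_lower_bound:
  fixes S :: "'i set \<Rightarrow> 'm pmf" and q :: "'m \<Rightarrow> 'i \<Rightarrow> real" and \<delta> :: real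
  assumes "finite I" "finite M" "\<delta> \<ge> 0"
    and S: "\<And>X. X \<subseteq> I \<Longrightarrow> set_pmf (S X) \<subseteq> M"
    and q: "\<And>m i. q m i \<in> {0..1}"
    and mem: "\<And>X i. X \<subseteq> I \<Longrightarrow> i \<in> X \<Longrightarrow> measure_pmf.expectation (S X) (\<lambda>m. q m i) \<ge> 1/2 + \<delta>"
    and not_mem: "\<And>X i. X \<subseteq> I \<Longrightarrow> i \<in> I - X \<Longrightarrow>
                    measure_pmf.expectation (S X) (\<lambda>m. q m i) \<le> 1/2 - \<delta>"
  shows "exp (2 * \<delta>\<^sup>2 * card I) \<le> card M"
proof -
  \<comment> \<open>With the guess centred at 1/2, \<open>\<sigma> X i * d m i\<close> is the excess
    over 1/2 of the probability of guessing bit \<open>i\<close> of \<open>X\<close> correctly from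
    \<open>m\<close>.\<close>
  define d where "d m i = q m i - 1/2" for m i
  define \<sigma> where "\<sigma> X i = (if i \<in> X then 1 else - 1 :: real)" for X :: "'i set" and i
  define N where "N = real (card I)"
  have ex: "\<exists>m\<in>M. (\<Sum>i\<in>I. \<sigma> X i * d m i) \<ge> N * \<delta>" if X: "X \<subseteq> I" for X
  proof (rule ccontr)
    assume neg: "\<not> ?thesis"
    have fin: "finite (set_pmf (S X))"
      using S[OF X] assms(2) finite_subset by blast
    have int: "integrable (measure_pmf (S X)) f" for f :: "'m \<Rightarrow> real"
      by (rule integrable_measure_pmf_finite[OF fin])
    have "N * \<delta> = (\<Sum>i\<in>I. \<delta>)"
      by (simp add: N_def)
    also have "\<dots> \<le> (\<Sum>i\<in>I. measure_pmf.expectation (S X) (\<lambda>m. \<sigma> X i * d m i))"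
    proof (rule sum_mono)
      fix i assume "i \<in> I"
      have "measure_pmf.expectation (S X) (\<lambda>m. d m i) = measure_pmf.expectation (S X) (\<lambda>m. q m i) - 1/2"
        unfolding d_def by (subst Bochner_Integration.integral_diff) (auto intro: int)
      thus "\<delta> \<le> measure_pmf.expectation (S X) (\<lambda>m. \<sigma> X i * d m i)"
        using mem[OF X, of i] not_mem[OF X, of i] \<open>i \<in> I\<close> by (auto simp: \<sigma>_def)
    qed
    also have "\<dots> = measure_pmf.expectation (S X) (\<lambda>m. \<Sum>i\<in>I. \<sigma> X i * d m i)"
      by (rule Bochner_Integration.integral_sum[symmetric]) (rule int)
    also have "\<dots> < N * \<delta>"
      using neg S[OF X] by (intro measure_pmf.expectation_less int) (force simp: AE_measure_pmf_iff)
    finally show False by simp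
  qed
  \<comment> \<open>For a weight parameter \<lambda>, the threshold contributes exponent \<lambda>
    \<delta> N and the moment bound costs \<lambda>^2 N / 8, because \<open>d\<close> is at most 1/2
    in absolute value. The gap is largest at \<lambda> = 4 \<delta>, where it equals 2 \<delta>^2
    N.\<close>
  define w where "w m X = exp (4 * \<delta> * (\<Sum>i\<in>I. \<sigma> X i * d m i))" for m X
  have "2 ^ card I * exp (4 * \<delta>\<^sup>2 * N) = (\<Sum>X\<in>Pow I. exp (4 * \<delta>\<^sup>2 * N))"
    using assms(1) by (simp add: card_Pow)
  \<comment> \<open>Union bound over messages: the good message depends on \<open>X\<close>, so it
    is replaced by the sum over all of \<open>M\<close>, after which each message can be treated
    separately.\<close>
  also have "\<dots> \<le> (\<Sum>X\<in>Pow I. \<Sum>m\<in>M. w m X)"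
  proof (rule sum_mono)
    fix X assume "X \<in> Pow I"
    then obtain m where m: "m \<in> M" "(\<Sum>i\<in>I. \<sigma> X i * d m i) \<ge> N * \<delta>"
      using ex by auto
    have "4 * \<delta> * (\<Sum>i\<in>I. \<sigma> X i * d m i) \<ge> 4 * \<delta> * (N * \<delta>)"
      using m(2) \<open>\<delta> \<ge> 0\<close> by (intro mult_left_mono) auto
    hence "exp (4 * \<delta>\<^sup>2 * N) \<le> w m X"
      by (simp add: w_def power2_eq_square mult_ac)
    also have "\<dots> \<le> (\<Sum>m\<in>M. w m X)"
      using m(1) \<open>finite M\<close> by (intro member_le_sum) (auto simp: w_def)
    finally show "exp (4 * \<delta>\<^sup>2 * N) \<le> (\<Sum>m\<in>M. w m X)" .
  qed
  also have "\<dots> = (\<Sum>m\<in>M. \<Sum>X\<in>Pow I. w m X)"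
    by (rule sum.swap)
  also have "\<dots> \<le> (\<Sum>m\<in>M. 2 ^ card I * exp (2 * \<delta>\<^sup>2 * N))"
  proof (rule sum_mono)
    fix m
    have "(\<Sum>X\<in>Pow I. w m X) =
          (\<Sum>X\<in>Pow I. \<Prod>i\<in>I. if i \<in> X then exp (4 * \<delta> * d m i) else exp (- (4 * \<delta> * d m i)))"
      using assms(1)
      by (intro sum.cong refl)
         (auto simp: w_def sum_distrib_left exp_sum \<sigma>_def intro!: prod.cong)
    also have "\<dots> = (\<Prod>i\<in>I. 2 * cosh (4 * \<delta> * d m i))"
      by (subst sum_Pow_prod_if[OF assms(1)]) (simp add: cosh_field_def add_divide_distrib)
    also have "\<dots> \<le> (\<Prod>i\<in>I. 2 * exp (2 * \<delta>\<^sup>2))"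
    proof (rule prod_mono, intro conjI mult_left_mono)
      fix i
      have "\<bar>d m i\<bar> \<le> \<bar>1/2\<bar>"
        using q[of m i] unfolding d_def atLeastAtMost_iff by linarith
      hence "(d m i)\<^sup>2 \<le> (1/2)\<^sup>2"
        by (simp only: abs_le_square_iff)
      hence "16 * \<delta>\<^sup>2 * (d m i)\<^sup>2 \<le> 16 * \<delta>\<^sup>2 * (1/2)\<^sup>2"
        by (intro mult_left_mono) auto
      hence "(4 * \<delta> * d m i)\<^sup>2 / 2 \<le> 2 * \<delta>\<^sup>2"
        by (simp add: power_mult_distrib power_divide)
      thus "cosh (4 * \<delta> * d m i) \<le> exp (2 * \<delta>\<^sup>2)"
        using cosh_le_exp_square[of "4 * \<delta> * d m i"] by (meson exp_le_cancel_iff order_trans)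
    qed auto
    also have "\<dots> = 2 ^ card I * exp (2 * \<delta>\<^sup>2 * N)"
      by (simp add: power_mult_distrib N_def mult_ac flip: exp_of_nat_mult)
    finally show "(\<Sum>X\<in>Pow I. w m X) \<le> 2 ^ card I * exp (2 * \<delta>\<^sup>2 * N)" .
  qed
  also have "\<dots> = 2 ^ card I * (card M * exp (2 * \<delta>\<^sup>2 * N))"
    by simp
  finally have "exp (4 * \<delta>\<^sup>2 * N) \<le> card M * exp (2 * \<delta>\<^sup>2 * N)"
    by simp
  moreover have "exp (4 * \<delta>\<^sup>2 * N) = exp (2 * \<delta>\<^sup>2 * N) * exp (2 * \<delta>\<^sup>2 * N)"
    by (simp flip: exp_add)
  ultimately show ?thesis
    by (simp add: N_def)
qed

section \<open>The query gadget on graphs\<close>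

lemma pendant_vertex_cover_iff:
  assumes "finite W" "W \<subseteq> V" "e \<subseteq> W" "card e = 2" "X \<subseteq> {f. f \<subseteq> W \<and> card f = 2}"
    and g: "inj_on g (W - e)" "g ` (W - e) \<inter> W = {}"
  shows "(\<exists>C. vertex_cover V (X \<union> (\<lambda>v. {v, g v}) ` (W - e)) C \<and> finite C \<and> card C \<le> card (W - e))
           \<longleftrightarrow> e \<notin> X"
proof
  assume "e \<notin> X"
  have "f \<inter> (W - e) \<noteq> {}" if "f \<in> X" for f
  proof
    assume "f \<inter> (W - e) = {}"
    moreover have f: "f \<subseteq> W" "card f = 2" "f \<noteq> e"
      using assms(5) that \<open>e \<notin> X\<close> by auto
    ultimately have "f \<subseteq> e" by auto
    moreover have "finite e"
      using assms(1,3) finite_subset by blast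
    ultimately show False
      using card_subset_eq[of e f] f assms(4) by auto
  qed
  hence "vertex_cover V (X \<union> (\<lambda>v. {v, g v}) ` (W - e)) (W - e)"
    using assms(2) by (auto simp: vertex_cover_def)
  thus "\<exists>C. vertex_cover V (X \<union> (\<lambda>v. {v, g v}) ` (W - e)) C \<and> finite C \<and> card C \<le> card (W - e)"
    using assms(1) by blast
next
  assume "\<exists>C. vertex_cover V (X \<union> (\<lambda>v. {v, g v}) ` (W - e)) C \<and> finite C \<and> card C \<le> card (W - e)"
  then obtain C where C: "vertex_cover V (X \<union> (\<lambda>v. {v, g v}) ` (W - e)) C" "finite C"
    "card C \<le> card (W - e)" by blast
  show "e \<notin> X"
  proof
    assume "e \<in> X"
    then obtain u where u: "u \<in> e" "u \<in> C"
      using C(1) by (auto simp: vertex_cover_def)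
    \<comment> \<open>\<open>h\<close> picks a covering endpoint of each pendant edge. These are
      distinct and differ from \<open>u\<close>, since \<open>g\<close> is injective with values
      outside \<open>W\<close> and \<open>u\<close> lies in \<open>e\<close>; so \<open>C\<close>
      has one vertex too many.\<close>
    define h where "h v = (if v \<in> C then v else g v)" for v
    have hC: "h v \<in> C" if "v \<in> W - e" for v
    proof -
      have "{v, g v} \<inter> C \<noteq> {}"
        using C(1) that unfolding vertex_cover_def by blast
      thus ?thesis
        by (auto simp: h_def)
    qed
    have "inj_on h (W - e)"
      using g by (auto simp: inj_on_def h_def)
    hence "card (W - e) = card (h ` (W - e))"
      by (simp add: card_image)
    also have "\<dots> \<le> card (C - {u})"
    proof (rule card_mono)
      have "h v \<noteq> u" if "v \<in> W - e" for v
        using that u(1) assms(3) g(2) by (auto simp: h_def)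
      thus "h ` (W - e) \<subseteq> C - {u}"
        using hC by auto
    qed (use C(2) in auto)
    also have "\<dots> < card C"
      using C(2) u(2) by (rule card_Diff1_less)
    finally show False
      using C(3) by simp
  qed
qed

section \<open>Streaming algorithms as one-way protocols\<close>

text \<open>Markov property: since coins are fresh in every step, a run may first sample its
  starting memory and then continue from that fixed memory.\<close>

lemma foldl_bind_pmf:
  "foldl (\<lambda>M e. bind_pmf M (\<lambda>m. f m e)) M es =
     bind_pmf M (\<lambda>m. foldl (\<lambda>M e. bind_pmf M (\<lambda>m. f m e)) (return_pmf m) es)"
proof (induction es arbitrary: M)
  case Nil
  show ?case by (simp add: bind_return_pmf')
next
  case (Cons e es)
  have "foldl (\<lambda>M e. bind_pmf M (\<lambda>m. f m e)) M (e # es) =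
        bind_pmf (bind_pmf M (\<lambda>m. f m e))
          (\<lambda>m. foldl (\<lambda>M e. bind_pmf M (\<lambda>m. f m e)) (return_pmf m) es)"
    by (simp only: foldl_Cons Cons.IH[of "bind_pmf M (\<lambda>m. f m e)"])
  also have "\<dots> = bind_pmf M (\<lambda>m. foldl (\<lambda>M e. bind_pmf M (\<lambda>m. f m e)) (f m e) es)"
    unfolding bind_assoc_pmf by (intro bind_pmf_cong refl Cons.IH[symmetric])
  finally show ?case
    by (simp add: bind_return_pmf)
qed

definition answer_after :: "streaming_alg \<Rightarrow> nat set list \<Rightarrow> bool list \<Rightarrow> nat set option pmf" where
  "answer_after A fs m = bind_pmf (foldl (\<lambda>M e. bind_pmf M (\<lambda>m. update A m e)) (return_pmf m) fs) (answer A)"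

text \<open>The sketch of \<open>es\<close> is the single message of the protocol;
  \<open>answer_after\<close> is the receiver, who resumes the run on \<open>fs\<close>.\<close>

lemma result_append: "result A (es @ fs) = bind_pmf (sketch A es) (answer_after A fs)"
  unfolding result_def sketch_def answer_after_def foldl_append
  by (subst foldl_bind_pmf) (simp add: bind_assoc_pmf)

lemma length_sketch_le_space:
  assumes "space_used n A = enat s" "es \<in> edge_streams n" "m \<in> set_pmf (sketch A es)"
  shows "length m \<le> s"
proof -
  have "enat (length m) \<le> space_used n A"
    unfolding space_used_def using assms(2,3) by (meson SUP_upper2 order_refl)
  thus ?thesis
    using assms(1) by simp
qed

text \<open>Sketches may have any length up to \<open>s\<close>, so the count exceeds
  \<open>2 ^ s\<close> in general; this is the source of the \<open>+ 1\<close> in the space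
  bound.\<close>

lemma card_bool_lists_le: "card {m :: bool list. length m \<le> s} < 2 ^ Suc s"
proof -
  have "card {m :: bool list. length m \<le> s} = (\<Sum>i\<le>s. 2 ^ i)"
    using card_lists_length_le[of "UNIV :: bool set" s] by simp
  also have "\<dots> = (2::nat) ^ Suc s - 1"
    using sum_power2[of "Suc s"] by (simp add: lessThan_Suc_atMost atLeast0LessThan)
  also have "\<dots> < 2 ^ Suc s"
    by simp
  finally show ?thesis .
qed

section \<open>Reduction from INDEX to vertex cover, and the quadratic bound\<close>

theorem PSA_VC_space_lower_bound:
  assumes A: "is_PSA_VC p n k A" and "p \<ge> 1/2" "n \<ge> 2 * k + 2" and s: "space_used n A = enat s"
  shows "2 * (p - 1/2)\<^sup>2 * real ((k + 2) choose 2) \<le> real s + 1"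
proof -
  define I where "I = {e. e \<subseteq> {..<k + 2} \<and> card e = 2}"
  have fin: "finite I"
    unfolding I_def by (rule finite_subset[of _ "Pow {..<k + 2}"]) auto
  have cardI: "card I = (k + 2) choose 2"
    unfolding I_def by (subst n_subsets) auto

  have "\<exists>es. set es = X \<and> distinct es" if "X \<subseteq> I" for X
    using finite_distinct_list finite_subset[OF that fin] by blast
  \<comment> \<open>One edge order is fixed per graph, independently of the query, so the message
    depends on \<open>X\<close> alone.\<close>
  then obtain enc where enc: "set (enc X) = X" "distinct (enc X)" if "X \<subseteq> I" for X
    by metis

  have cardR: "card ({..<k + 2} - e) = k" if "e \<in> I" for e
    using that by (subst card_Diff_subset) (auto simp: I_def intro: finite_subset)
  have "\<exists>g. bij_betw g ({..<k + 2} - e) {k + 2..<2 * k + 2}" if "e \<in> I" for e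
    using cardR[OF that] by (intro finite_same_card_bij) auto
  \<comment> \<open>The pendant partners are \<open>k\<close> fresh vertices; together with the
    \<open>k + 2\<close> vertices carrying \<open>X\<close> they account for
    \<open>n \<ge> 2 * k + 2\<close>.\<close>
  then obtain g where g: "bij_betw (g e) ({..<k + 2} - e) {k + 2..<2 * k + 2}" if "e \<in> I" for e
    by metis
  define pend where "pend e = (\<lambda>v. {v, g e v}) ` ({..<k + 2} - e)" for e
  have "\<exists>es. set es = pend e \<and> distinct es" for e
    by (intro finite_distinct_list) (simp add: pend_def)
  then obtain qry where qry: "set (qry e) = pend e" "distinct (qry e)" for e
    by metis

  have g_range: "g e v \<in> {k + 2..<2 * k + 2}" if "e \<in> I" "v \<in> {..<k + 2} - e" for e v
    using g[OF that(1)] that(2) by (auto simp: bij_betw_def)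

  have stream: "enc X @ qry e \<in> edge_streams n" if X: "X \<subseteq> I" and e: "e \<in> I" for X e
  proof -
    \<comment> \<open>The clause \<open>f \<notin> I\<close> keeps the concatenated stream free of
      repeated edges.\<close>
    have "f \<subseteq> {..<n} \<and> card f = 2 \<and> f \<notin> I" if f: "f \<in> pend e" for f
    proof -
      obtain v where v: "v \<in> {..<k + 2} - e" "f = {v, g e v}"
        using f by (auto simp: pend_def)
      show ?thesis
        using v g_range[OF e v(1)] \<open>n \<ge> 2 * k + 2\<close> by (auto simp: I_def)
    qed
    moreover have "f \<subseteq> {..<n} \<and> card f = 2" if "f \<in> X" for f
      using that X \<open>n \<ge> 2 * k + 2\<close> by (fastforce simp: I_def)
    ultimately show ?thesis
      using enc[OF X] qry[of e] X by (auto simp: edge_streams_def)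
  qed

  have enc_stream: "enc X \<in> edge_streams n" if X: "X \<subseteq> I" for X
    using enc[OF X] X \<open>n \<ge> 2 * k + 2\<close> by (fastforce simp: edge_streams_def I_def)

  have cover_iff: "(\<exists>C. vertex_cover {..<n} (set (enc X @ qry e)) C \<and> finite C \<and> card C \<le> k) \<longleftrightarrow> e \<notin> X"
    if X: "X \<subseteq> I" and e: "e \<in> I" for X e
  proof -
    have "(\<exists>C. vertex_cover {..<n} (X \<union> pend e) C \<and> finite C \<and> card C \<le> card ({..<k + 2} - e)) \<longleftrightarrow> e \<notin> X"
      unfolding pend_def
    proof (rule pendant_vertex_cover_iff)
      show "inj_on (g e) ({..<k + 2} - e)"
        using g[OF e] by (simp add: bij_betw_def)
      show "g e ` ({..<k + 2} - e) \<inter> {..<k + 2} = {}"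
        using g_range[OF e] by fastforce
    qed (use X e \<open>n \<ge> 2 * k + 2\<close> in \<open>auto simp: I_def\<close>)
    thus ?thesis
      using enc(1)[OF X] qry(1)[of e] cardR[OF e] by simp
  qed

  \<comment> \<open>Reporting that no cover exists is read as the claim
    \<open>e \<in> X\<close>.\<close>
  define q where "q m e = pmf (answer_after A (qry e) m) None" for m e
  have q_expectation: "measure_pmf.expectation (sketch A (enc X)) (\<lambda>m. q m e) = pmf (result A (enc X @ qry e)) None"
    for X e by (simp add: q_def result_append pmf_bind)
  have correct: "p \<le> measure_pmf.prob (result A (enc X @ qry e))
                   {a. correct_VC {..<n} k (set (enc X @ qry e)) a}" if "X \<subseteq> I" "e \<in> I" for X e
    using A stream[OF that] by (auto simp: is_PSA_VC_def)

  have "exp (2 * (p - 1/2)\<^sup>2 * card I) \<le> card {m :: bool list. length m \<le> s}"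
  proof (rule index_lower_bound[where S = "\<lambda>X. sketch A (enc X)" and q = q])
    show "finite {m :: bool list. length m \<le> s}"
      using finite_lists_length_le[of "UNIV :: bool set" s] by simp
    show "set_pmf (sketch A (enc X)) \<subseteq> {m. length m \<le> s}" if "X \<subseteq> I" for X
      using length_sketch_le_space[OF s enc_stream[OF that]] by auto
    show "q m e \<in> {0..1}" for m e
      by (simp add: q_def pmf_le_1)
    show "1/2 + (p - 1/2) \<le> measure_pmf.expectation (sketch A (enc X)) (\<lambda>m. q m e)"
      if X: "X \<subseteq> I" and e: "e \<in> X" for X e
    proof -
      have eI: "e \<in> I"
        using X e by auto
      have "a = None" if "correct_VC {..<n} k (set (enc X @ qry e)) a" for a
        using that cover_iff[OF X eI] e by (cases a) auto
      hence "{a. correct_VC {..<n} k (set (enc X @ qry e)) a} \<subseteq> {None}"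
        by blast
      hence "p \<le> measure_pmf.prob (result A (enc X @ qry e)) {None}"
        by (intro order_trans[OF correct[OF X eI]] measure_pmf.finite_measure_mono) auto
      thus ?thesis
        by (simp add: q_expectation measure_pmf_single)
    qed
    show "measure_pmf.expectation (sketch A (enc X)) (\<lambda>m. q m e) \<le> 1/2 - (p - 1/2)"
      if X: "X \<subseteq> I" and e: "e \<in> I - X" for X e
    proof -
      have eI: "e \<in> I"
        using e by auto
      have "\<not> correct_VC {..<n} k (set (enc X @ qry e)) None"
        using cover_iff[OF X eI] e by simp
      hence "{a. correct_VC {..<n} k (set (enc X @ qry e)) a} \<subseteq> - {None}"
        by auto
      hence "p \<le> measure_pmf.prob (result A (enc X @ qry e)) (- {None})"
        by (intro order_trans[OF correct[OF X eI]] measure_pmf.finite_measure_mono) auto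
      also have "\<dots> = 1 - pmf (result A (enc X @ qry e)) None"
        using measure_pmf.prob_compl[of "{None}" "result A (enc X @ qry e)"]
        by (simp add: measure_pmf_single Compl_eq_Diff_UNIV)
      finally show ?thesis
        by (simp add: q_expectation)
    qed
  qed (use fin \<open>p \<ge> 1/2\<close> in auto)
  also have "real (card {m :: bool list. length m \<le> s}) \<le> 2 ^ Suc s"
    using card_bool_lists_le[of s] by (metis less_imp_le of_nat_le_iff of_nat_numeral of_nat_power)
  \<comment> \<open>Weakening base 2 to e lets the exponents be compared directly, without a factor
    \<open>ln 2\<close>.\<close>
  also have "(2::real) ^ Suc s \<le> exp 1 ^ Suc s"
    using exp_ge_add_one_self[of 1] by (intro power_mono) auto
  also have "\<dots> = exp (real s + 1)"
    using exp_of_nat_mult[of "Suc s" "1 :: real"] by (simp add: add_ac)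
  finally show ?thesis
    by (simp add: cardI)
qed

theorem theorem2:
  fixes p :: real
  assumes "p > 1/2"
  shows "\<exists>c>0. \<exists>k\<^sub>0::nat. \<forall>k\<ge>k\<^sub>0. \<forall>n\<ge>2 * k + 2. \<forall>A.
           is_PSA_VC p n k A \<longrightarrow> ereal (c * (real k)\<^sup>2) \<le> ereal_of_enat (space_used n A)"
proof -
  define \<delta> where "\<delta> = p - 1/2"
  have "\<delta> > 0"
    using assms by (simp add: \<delta>_def)
  \<comment> \<open>Chosen so that \<delta>^2 k is at least 1: the linear term of twice the binomial
    coefficient, times \<delta>^2, then absorbs the \<open>+ 1\<close> next to \<open>s\<close>,
    leaving the constant \<delta>^2.\<close>
  define k\<^sub>0 where "k\<^sub>0 = nat \<lceil>1 / \<delta>\<^sup>2\<rceil>"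
  have "ereal (\<delta>\<^sup>2 * (real k)\<^sup>2) \<le> ereal_of_enat (space_used n A)"
    if k: "k \<ge> k\<^sub>0" and n: "n \<ge> 2 * k + 2" and A: "is_PSA_VC p n k A" for k n A
  proof (cases "space_used n A")
    case (enat s)
    have "real k \<ge> 1 / \<delta>\<^sup>2"
      using k unfolding k\<^sub>0_def by linarith
    hence large: "\<delta>\<^sup>2 * real k \<ge> 1"
      using \<open>\<delta> > 0\<close> by (simp add: field_simps)
    have "real ((k + 2) choose 2) = real ((k + 2) * (k + 1)) / 2"
      by (simp add: choose_two real_of_nat_div)
    hence "2 * real ((k + 2) choose 2) = (real k)\<^sup>2 + 3 * real k + 2"
      by (simp add: field_simps power2_eq_square)
    moreover have "\<delta>\<^sup>2 * (2 * real ((k + 2) choose 2)) \<le> real s + 1"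
      using PSA_VC_space_lower_bound[OF A _ n enat] assms by (simp add: \<delta>_def mult_ac)
    ultimately have "\<delta>\<^sup>2 * (real k)\<^sup>2 + 3 * (\<delta>\<^sup>2 * real k) + 2 * \<delta>\<^sup>2 \<le> real s + 1"
      by (simp add: algebra_simps)
    hence "\<delta>\<^sup>2 * (real k)\<^sup>2 \<le> real s"
      using large zero_le_power2[of \<delta>] by linarith
    thus ?thesis
      by (simp add: enat)
  qed simp
  thus ?thesis
    using \<open>\<delta> > 0\<close> by (intro exI[of _ "\<delta>\<^sup>2"] conjI exI[of _ k\<^sub>0]) auto
qed

end
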